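(* Let $G$ be a finitely generated group, $K$ a subgroup of $G$, and $\psi:\Sigma\to G$ a semigroup presentation of $G$. Let $H$ be a finitely generated subgroup of $G$, and let $\psi':\Sigma'\to H$ be a semigroup presentation of $H$ (with $\Sigma'$ another finite alphabet). If $L(G,K,\psi)$ is context-free, then $L(H,K\cap H,\psi')$ is also context-free; and if in addition $L(G,K,\psi)$ is deterministic context-free, then so is $L(H,K\cap H,\psi')$.
   Context: A *semigroup presentation* of a finitely generated group $G$ is a (not necessarily injective) map $\psi:\Sigma\to G$ from a finite alphabet $\Sigma$ such that its extension to a monoid homomorphism $\psi:\Sigma^*\to G$ is surjective. For a subgroup $K\le G$ (not necessarily finitely generated), $L(G,K,\psi)=\{w\in\Sigma^*:\psi(w)\in K\}$. A pushdown automaton is $(Q,\Sigma,Z,\delta,q_0,Q_f,z_0)$ with finite sets $Q$ (states), $\Sigma$ (input alphabet), $Z$ (stack symbols), $q_0\in Q$, $Q_f\subset Q$, $z_0\in Z$, and $\delta$ a map from $Q\times(\Sigma\cup\{\epsilon\})\times(Z\cup\{\epsilon\})$ to the finite subsets of $Q\times Z^*$, $\epsilon$ being the empty word. In state $p$, with top (rightmost) stack symbol $z$ (or $z=\epsilon$ if the stack is empty), it may choose $(q,\zeta')\in\delta(p,a,z)$, where $a$ is the next input letter, consume $a$, go to state $q$ and replace $z$ by $\zeta'$; or choose $(q,\zeta')\in\delta(p,\epsilon,z)$ and do the same without consuming input. A word is accepted if, starting in state $q_0$ with stack $z_0$, the automaton can reach after finitely many transitions a final state (in $Q_f$) with empty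 stack and with all input consumed. It is deterministic if $|\delta(p,a,z)|+|\delta(p,\epsilon,z)|\le 1$ for all $p\in Q$, $a\in\Sigma$, $z\in Z\cup\{\epsilon\}$. A language is context-free iff it is accepted by some pushdown automaton; a context-free language is *deterministic* if it is accepted by some deterministic pushdown automaton. *)

theory Defs
  imports "HOL-Algebra.Generated_Groups"
begin

section \<open>Pushdown automata\<close>

text \<open>In the second and third arguments of \<open>delta\<close>, \<open>None\<close> stands for the empty
  word \<open>\<epsilon>\<close>. Stacks are lists whose top is the \<^emph>\<open>last\<close> element.\<close>

record ('q, 'a, 'z) pda =
  states :: "'q set"
  alphabet :: "'a set"
  stack_symbols :: "'z set"
  delta :: "'q \<Rightarrow> 'a option \<Rightarrow> 'z option \<Rightarrow> ('q \<times> 'z list) set"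
  initial :: "'q"
  finals :: "'q set"
  initial_stack :: "'z"

definition pushdown_automaton :: "('q, 'a, 'z) pda \<Rightarrow> bool" where
  "pushdown_automaton M \<longleftrightarrow>
     finite (states M) \<and> finite (alphabet M) \<and> finite (stack_symbols M) \<and>
     initial M \<in> states M \<and> finals M \<subseteq> states M \<and> initial_stack M \<in> stack_symbols M \<and>
     (\<forall>p \<in> states M. \<forall>x \<in> insert None (Some ` alphabet M).
       \<forall>z \<in> insert None (Some ` stack_symbols M).
         finite (delta M p x z) \<and> delta M p x z \<subseteq> states M \<times> lists (stack_symbols M))"

definition deterministic_pda :: "('q, 'a, 'z) pda \<Rightarrow> bool" where
  "deterministic_pda M \<longleftrightarrow>
     (\<forall>p \<in> states M. \<forall>a \<in> alphabet M. \<forall>z \<in> insert None (Some ` stack_symbols M).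
        card (delta M p (Some a) z) + card (delta M p None z) \<le> 1)"

definition stack_top :: "'z list \<Rightarrow> 'z option" where
  "stack_top \<zeta> = (if \<zeta> = [] then None else Some (last \<zeta>))"

text \<open>A configuration consists of the state, the remaining input and the stack. Transitions with
  stack argument \<open>\<epsilon>\<close> apply only when the stack is empty; in that case \<open>butlast \<zeta> = []\<close>, so the new
  stack is just the word pushed.\<close>

inductive pda_step ::
    "('q, 'a, 'z) pda \<Rightarrow> 'q \<times> 'a list \<times> 'z list \<Rightarrow> 'q \<times> 'a list \<times> 'z list \<Rightarrow> bool"
  for M where
  read: "(q, \<zeta>') \<in> delta M p (Some a) (stack_top \<zeta>) \<Longrightarrow>
           pda_step M (p, a # w, \<zeta>) (q, w, butlast \<zeta> @ \<zeta>')"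
| epsilon: "(q, \<zeta>') \<in> delta M p None (stack_top \<zeta>) \<Longrightarrow>
           pda_step M (p, w, \<zeta>) (q, w, butlast \<zeta> @ \<zeta>')"

definition pda_language :: "('q, 'a, 'z) pda \<Rightarrow> 'a list set" where
  "pda_language M = {w \<in> lists (alphabet M). \<exists>q \<in> finals M.
     (pda_step M)\<^sup>*\<^sup>* (initial M, w, [initial_stack M]) (q, [], [])}"

text \<open>The first argument is the alphabet over which the language is considered. Since the sets of
  states and of stack symbols are finite, taking both to consist of natural numbers is no
  restriction.\<close>

definition context_free :: "'a set \<Rightarrow> 'a list set \<Rightarrow> bool" where
  "context_free \<Sigma> L \<longleftrightarrow>
     (\<exists>M :: (nat, 'a, nat) pda. pushdown_automaton M \<and> alphabet M = \<Sigma> \<and> pda_language M = L)"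

definition deterministic_context_free :: "'a set \<Rightarrow> 'a list set \<Rightarrow> bool" where
  "deterministic_context_free \<Sigma> L \<longleftrightarrow>
     (\<exists>M :: (nat, 'a, nat) pda. pushdown_automaton M \<and> deterministic_pda M \<and>
        alphabet M = \<Sigma> \<and> pda_language M = L)"

section \<open>Semigroup presentations\<close>

definition finitely_generated :: "('g, 'm) monoid_scheme \<Rightarrow> bool" where
  "finitely_generated G \<longleftrightarrow> (\<exists>S. finite S \<and> S \<subseteq> carrier G \<and> generate G S = carrier G)"

definition word_value :: "('g, 'm) monoid_scheme \<Rightarrow> ('a \<Rightarrow> 'g) \<Rightarrow> 'a list \<Rightarrow> 'g" where
  "word_value G \<psi> w = foldr (mult G) (map \<psi> w) (one G)"

definition semigroup_presentation ::
    "('g, 'm) monoid_scheme \<Rightarrow> 'a set \<Rightarrow> ('a \<Rightarrow> 'g) \<Rightarrow> bool" where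
  "semigroup_presentation G \<Sigma> \<psi> \<longleftrightarrow>
     finite \<Sigma> \<and> \<psi> ` \<Sigma> \<subseteq> carrier G \<and> word_value G \<psi> ` lists \<Sigma> = carrier G"

definition subgroup_language ::
    "('g, 'm) monoid_scheme \<Rightarrow> 'g set \<Rightarrow> 'a set \<Rightarrow> ('a \<Rightarrow> 'g) \<Rightarrow> 'a list set" where
  "subgroup_language G K \<Sigma> \<psi> = {w \<in> lists \<Sigma>. word_value G \<psi> w \<in> K}"

end

theory Submission
  imports Defs "HOL-Library.Sublist"
begin

text \<open>Choosing for each letter \<open>a\<close> of \<open>\<Sigma>'\<close> a word \<open>h a\<close> over \<open>\<Sigma>\<close> with the same value turns the
  language of \<open>K \<inter> H\<close> into the inverse image of the language of \<open>K\<close> under the homomorphism \<open>h\<close>.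
  An automaton for the inverse image keeps in its state the part of the current \<open>h a\<close> that is not
  yet consumed, and feeds it to the given automaton. If every \<open>h a\<close> is nonempty, the
  step that reads \<open>a\<close> can at the same time consume the first letter of \<open>h a\<close>, so runs correspond
  step by step and determinism is preserved. Nonempty \<open>h a\<close> exist unless \<open>\<Sigma>\<close> is empty, and then
  \<open>G\<close> is trivial.\<close>

section \<open>Runs of pushdown automata\<close>

text \<open>Each language equality below applies this twice, with \<open>S\<close> read once in
  either direction. Only some partner \<open>y'\<close> is produced, so accepting configurations
  must afterwards be recognised through \<open>S\<close>.\<close>

lemma rtranclp_simulation:
  assumes "R\<^sup>*\<^sup>* x y" and "S x x'"
    and "\<And>x y x'. R x y \<Longrightarrow> S x x' \<Longrightarrow> \<exists>y'. S y y' \<and> R' x' y'"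
  shows "\<exists>y'. S y y' \<and> R'\<^sup>*\<^sup>* x' y'"
  using assms(1,2)
proof (induction rule: rtranclp_induct)
  case base
  then show ?case by blast
next
  case (step y z)
  then obtain y' where "S y y'" "R'\<^sup>*\<^sup>* x' y'" by blast
  with assms(3)[OF step.hyps(2)] show ?case
    by (meson rtranclp.rtrancl_into_rtrancl)
qed

text \<open>Treats both kinds of step at once through an optional letter \<open>x\<close>, so that
  renaming states needs no case distinction.\<close>

lemma pda_step_iff:
  "pda_step M (p, w, \<zeta>) c \<longleftrightarrow>
     (\<exists>x w' q \<zeta>'. w = (case x of None \<Rightarrow> w' | Some a \<Rightarrow> a # w') \<and>
        (q, \<zeta>') \<in> delta M p x (stack_top \<zeta>) \<and> c = (q, w', butlast \<zeta> @ \<zeta>'))"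
  (is "_ \<longleftrightarrow> ?R")
proof
  assume "pda_step M (p, w, \<zeta>) c"
  then show ?R
  proof cases
    case (read q \<zeta>' a w')
    then show ?thesis by (intro exI[of _ "Some a"]) auto
  next
    case (epsilon q \<zeta>')
    then show ?thesis by (intro exI[of _ None]) auto
  qed
next
  assume ?R
  then show "pda_step M (p, w, \<zeta>) c"
    by (auto split: option.splits intro: pda_step.intros)
qed

lemma stack_top_mem: "\<zeta> \<in> lists Z \<Longrightarrow> stack_top \<zeta> \<in> insert None (Some ` Z)"
  by (auto simp: stack_top_def)

lemma pushdown_automaton_delta:
  assumes "pushdown_automaton M" "p \<in> states M"
    and "x \<in> insert None (Some ` alphabet M)" "z \<in> insert None (Some ` stack_symbols M)"
  shows "finite (delta M p x z)" "delta M p x z \<subseteq> states M \<times> lists (stack_symbols M)"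
  using assms unfolding pushdown_automaton_def by blast+

section \<open>Renaming states\<close>

text \<open>Serves to bring automata with structured states back to states in \<open>nat\<close>, as
  \<open>context_free\<close> demands. The use of \<open>inv_into\<close> recovers the old state
  when \<open>f\<close> is injective on \<open>states M\<close>.\<close>

definition rename_states :: "('q \<Rightarrow> 'r) \<Rightarrow> ('q, 'a, 'z) pda \<Rightarrow> ('r, 'a, 'z) pda" where
  "rename_states f M =
     \<lparr>states = f ` states M, alphabet = alphabet M, stack_symbols = stack_symbols M,
      delta = (\<lambda>p x z. apfst f ` delta M (inv_into (states M) f p) x z),
      initial = f (initial M), finals = f ` finals M, initial_stack = initial_stack M\<rparr>"

lemma rename_states_simps [simp]:
  "states (rename_states f M) = f ` states M"
  "alphabet (rename_states f M) = alphabet M"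
  "stack_symbols (rename_states f M) = stack_symbols M"
  "initial (rename_states f M) = f (initial M)"
  "finals (rename_states f M) = f ` finals M"
  "initial_stack (rename_states f M) = initial_stack M"
  by (simp_all add: rename_states_def)

lemma delta_rename_states:
  assumes "inj_on f (states M)" "p \<in> states M"
  shows "delta (rename_states f M) (f p) x z = apfst f ` delta M p x z"
  using assms by (simp add: rename_states_def)

lemma pushdown_automaton_rename_states:
  assumes M: "pushdown_automaton M" and f: "inj_on f (states M)"
  shows "pushdown_automaton (rename_states f M)"
proof -
  have "finite (delta (rename_states f M) (f p) x z) \<and>
      delta (rename_states f M) (f p) x z \<subseteq> f ` states M \<times> lists (stack_symbols M)"
    if "p \<in> states M" "x \<in> insert None (Some ` alphabet M)"
      "z \<in> insert None (Some ` stack_symbols M)" for p x z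
    using pushdown_automaton_delta[OF M that] that f
    by (auto simp: delta_rename_states)
  with M show ?thesis
    unfolding pushdown_automaton_def by auto
qed

text \<open>Taking images cannot increase the cardinality of a finite set. Finiteness of the
  transition sets comes from \<open>pushdown_automaton M\<close>; it matters because
  \<open>card\<close> is 0 on infinite sets.\<close>

lemma deterministic_rename_states:
  assumes M: "pushdown_automaton M" "deterministic_pda M" and f: "inj_on f (states M)"
  shows "deterministic_pda (rename_states f M)"
proof -
  have "card (apfst f ` delta M p (Some a) z) + card (apfst f ` delta M p None z) \<le> 1"
    if "p \<in> states M" "a \<in> alphabet M" "z \<in> insert None (Some ` stack_symbols M)" for p a z
  proof -
    have "card (delta M p (Some a) z) + card (delta M p None z) \<le> 1"
      using M(2) that unfolding deterministic_pda_def by blast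
    moreover have "finite (delta M p (Some a) z)" "finite (delta M p None z)"
      using pushdown_automaton_delta[OF M(1)] that by blast+
    ultimately show ?thesis
      using card_image_le[of "delta M p (Some a) z" "apfst f"]
        card_image_le[of "delta M p None z" "apfst f"] by linarith
  qed
  with f show ?thesis
    unfolding deterministic_pda_def by (auto simp: delta_rename_states)
qed

text \<open>On well-formed configurations, \<open>apfst f\<close> is a bisimulation between
  \<open>M\<close> and the renamed automaton.\<close>

lemma pda_language_rename_states:
  assumes M: "pushdown_automaton M" and f: "inj_on f (states M)"
  shows "pda_language (rename_states f M) = pda_language M"
proof -
  let ?N = "rename_states f M"
  \<comment> \<open>Outside \<open>states M\<close> the function \<open>f\<close> need not be
    injective and \<open>delta M\<close> is unconstrained, so the simulation is confined to
    \<open>C\<close>, which steps of \<open>M\<close> do not leave.\<close>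
  define C where "C = states M \<times> lists (alphabet M) \<times> lists (stack_symbols M)"
  have closed: "d \<in> C" if "pda_step M c d" "c \<in> C" for c d
  proof -
    obtain p w \<zeta> where c: "c = (p, w, \<zeta>)" by (cases c)
    from that(1) obtain x w' q \<zeta>' where *: "w = (case x of None \<Rightarrow> w' | Some a \<Rightarrow> a # w')"
      "(q, \<zeta>') \<in> delta M p x (stack_top \<zeta>)" "d = (q, w', butlast \<zeta> @ \<zeta>')"
      unfolding c pda_step_iff by blast
    have mem: "p \<in> states M" "w' \<in> lists (alphabet M)" "x \<in> insert None (Some ` alphabet M)"
      "\<zeta> \<in> lists (stack_symbols M)"
      using that(2) *(1) by (auto simp: C_def c split: option.splits)
    have "(q, \<zeta>') \<in> states M \<times> lists (stack_symbols M)"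
      using pushdown_automaton_delta(2)[OF M mem(1,3) stack_top_mem[OF mem(4)]] *(2) by blast
    moreover have "butlast \<zeta> \<in> lists (stack_symbols M)"
      using mem(4) by (auto dest: in_set_butlastD)
    ultimately show ?thesis
      using mem(2) by (simp add: C_def *(3))
  qed
  have step_iff: "pda_step ?N (apfst f c) d \<longleftrightarrow> (\<exists>d'. pda_step M c d' \<and> d = apfst f d')"
    if "c \<in> C" for c d
  proof -
    obtain p w \<zeta> where c: "c = (p, w, \<zeta>)" by (cases c)
    have p: "p \<in> states M" using that by (simp add: C_def c)
    show ?thesis
      unfolding c apfst_conv pda_step_iff delta_rename_states[OF f p]
      by (simp add: apfst_def map_prod_def image_iff Bex_def) blast
  qed
  have forward: "\<exists>d. (d \<in> C \<and> y = apfst f d) \<and> pda_step M c d"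
    if "pda_step ?N x y" "c \<in> C \<and> x = apfst f c" for x y c
    using that step_iff closed by blast
  have backward: "\<exists>y. (d \<in> C \<and> y = apfst f d) \<and> pda_step ?N x y"
    if "pda_step M c d" "c \<in> C \<and> x = apfst f c" for c d x
    using that step_iff closed by blast
  have "(\<exists>q \<in> finals ?N. (pda_step ?N)\<^sup>*\<^sup>* (initial ?N, w, [initial_stack ?N]) (q, [], [])) \<longleftrightarrow>
      (\<exists>q \<in> finals M. (pda_step M)\<^sup>*\<^sup>* (initial M, w, [initial_stack M]) (q, [], []))"
    (is "?L \<longleftrightarrow> ?R") if w: "w \<in> lists (alphabet M)" for w
  proof -
    let ?c = "(initial M, w, [initial_stack M])"
    have init: "?c \<in> C \<and> (f (initial M), w, [initial_stack M]) = apfst f ?c"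
      using M w by (auto simp: C_def pushdown_automaton_def)
    have finals: "finals M \<subseteq> states M"
      using M by (simp add: pushdown_automaton_def)
    show ?thesis
    proof
      assume ?L
      then obtain q where q: "q \<in> finals M"
        "(pda_step ?N)\<^sup>*\<^sup>* (f (initial M), w, [initial_stack M]) (f q, [], [])" by auto
      have "\<exists>c. (c \<in> C \<and> (f q, [], []) = apfst f c) \<and> (pda_step M)\<^sup>*\<^sup>* ?c c"
        by (rule rtranclp_simulation[where S = "\<lambda>x c. c \<in> C \<and> x = apfst f c",
              OF q(2) init forward])
      then obtain c where c: "c \<in> C" "(f q, [], []) = apfst f c" "(pda_step M)\<^sup>*\<^sup>* ?c c"
        by (elim exE conjE)
      then obtain q' where q': "c = (q', [], [])" "q' \<in> states M" "f q = f q'"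
        by (cases c) (auto simp: C_def)
      \<comment> \<open>The simulation only yields a state with the same image as \<open>q\<close>;
        both lie in \<open>states M\<close>, where \<open>f\<close> is injective.\<close>
      then have "q' = q"
        using f q(1) finals by (metis inj_onD subsetD)
      then show ?R using q(1) q' c(3) by blast
    next
      assume ?R
      then obtain q where q: "q \<in> finals M" "(pda_step M)\<^sup>*\<^sup>* ?c (q, [], [])" by blast
      have "\<exists>x. ((q, [], []) \<in> C \<and> x = apfst f (q, [], [])) \<and>
          (pda_step ?N)\<^sup>*\<^sup>* (f (initial M), w, [initial_stack M]) x"
        by (rule rtranclp_simulation[where S = "\<lambda>c x. c \<in> C \<and> x = apfst f c",
              OF q(2) init backward])
      then show ?L using q(1) by auto
    qed
  qed
  then show ?thesis unfolding pda_language_def by auto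
qed

text \<open>A finite set of states of any type embeds into \<open>nat\<close>. Stack symbols can
  stay in \<open>nat\<close> because the construction for inverse homomorphisms keeps the stack
  alphabet.\<close>

lemma context_freeI:
  fixes M :: "('q, 'a, nat) pda"
  assumes "pushdown_automaton M"
  shows "context_free (alphabet M) (pda_language M)"
proof -
  obtain f :: "'q \<Rightarrow> nat" where "inj_on f (states M)"
    using assms finite_imp_inj_to_nat_seg[of "states M"] by (auto simp: pushdown_automaton_def)
  then show ?thesis
    unfolding context_free_def
    by (intro exI[of _ "rename_states f M"] conjI pushdown_automaton_rename_states
        pda_language_rename_states assms) simp_all
qed

lemma deterministic_context_freeI:
  fixes M :: "('q, 'a, nat) pda"
  assumes "pushdown_automaton M" "deterministic_pda M"
  shows "deterministic_context_free (alphabet M) (pda_language M)"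
proof -
  obtain f :: "'q \<Rightarrow> nat" where "inj_on f (states M)"
    using assms finite_imp_inj_to_nat_seg[of "states M"] by (auto simp: pushdown_automaton_def)
  then show ?thesis
    unfolding deterministic_context_free_def
    by (intro exI[of _ "rename_states f M"] conjI pushdown_automaton_rename_states
        deterministic_rename_states pda_language_rename_states assms) simp_all
qed

lemma deterministic_context_free_imp_context_free:
  "deterministic_context_free \<Sigma> L \<Longrightarrow> context_free \<Sigma> L"
  unfolding deterministic_context_free_def context_free_def by blast

text \<open>Settles the case of an empty \<open>\<Sigma>\<close> in the theorem, where every word
  over the other alphabet has value in \<open>K\<close>.\<close>

lemma deterministic_context_free_lists:
  fixes \<Sigma> :: "'a set"
  assumes "finite \<Sigma>"
  shows "deterministic_context_free \<Sigma> (lists \<Sigma>)"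
proof -
  define M :: "(nat, 'a, nat) pda" where
    "M = \<lparr>states = {0}, alphabet = \<Sigma>, stack_symbols = {0},
          delta = (\<lambda>p x z. if (x = None) = (z = None) then {} else {(0, [])}),
          initial = 0, finals = {0}, initial_stack = 0\<rparr>"
  have pop: "pda_step M (0, w, [0]) (0, w, [])" for w
    using pda_step.epsilon[of 0 "[]" M 0 "[0]" w] by (simp add: M_def stack_top_def)
  have "(pda_step M)\<^sup>*\<^sup>* (0, w, []) (0, [], [])" for w
  proof (induction w)
    case (Cons a w)
    have "pda_step M (0, a # w, []) (0, w, [])"
      using pda_step.read[of 0 "[]" M 0 a "[]" w] by (simp add: M_def stack_top_def)
    then show ?case using Cons.IH by (rule converse_rtranclp_into_rtranclp)
  qed simp
  then have "(pda_step M)\<^sup>*\<^sup>* (0, w, [0]) (0, [], [])" for w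
    using pop converse_rtranclp_into_rtranclp by metis
  then have "pda_language M = lists \<Sigma>"
    by (auto simp: pda_language_def M_def)
  moreover have "pushdown_automaton M" "deterministic_pda M"
    using assms by (auto simp: pushdown_automaton_def deterministic_pda_def M_def)
  moreover have "alphabet M = \<Sigma>" by (simp add: M_def)
  ultimately show ?thesis using deterministic_context_freeI by metis
qed

section \<open>Inverse homomorphisms\<close>

text \<open>The second component of a state is the buffer. Buffers are suffixes of words
  \<open>h a\<close>, so there are finitely many; \<open>insert []\<close> provides the initial
  buffer even for empty \<open>B\<close>. Feeding a buffered letter to \<open>M\<close> is an
  \<epsilon>-move here, and \<epsilon>-moves of \<open>M\<close> are possible with any
  buffer.\<close>

definition inverse_hom_pda ::
    "'b set \<Rightarrow> ('b \<Rightarrow> 'a list) \<Rightarrow> ('q, 'a, 'z) pda \<Rightarrow> ('q \<times> 'a list, 'b, 'z) pda" where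
  "inverse_hom_pda B h M =
     \<lparr>states = states M \<times> insert [] (\<Union>a \<in> B. set (suffixes (h a))),
      alphabet = B, stack_symbols = stack_symbols M,
      delta = (\<lambda>(p, u) x z. case x of
          None \<Rightarrow> apfst (\<lambda>q. (q, u)) ` delta M p None z \<union>
            (case u of [] \<Rightarrow> {} | b # v \<Rightarrow> apfst (\<lambda>q. (q, v)) ` delta M p (Some b) z)
        | Some a \<Rightarrow> if u = [] then apfst (\<lambda>q. (q, tl (h a))) ` delta M p (Some (hd (h a))) z
            else {}),
      initial = (initial M, []), finals = finals M \<times> {[]}, initial_stack = initial_stack M\<rparr>"

lemma inverse_hom_pda_simps [simp]:
  "states (inverse_hom_pda B h M) = states M \<times> insert [] (\<Union>a \<in> B. set (suffixes (h a)))"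
  "alphabet (inverse_hom_pda B h M) = B"
  "stack_symbols (inverse_hom_pda B h M) = stack_symbols M"
  "initial (inverse_hom_pda B h M) = (initial M, [])"
  "finals (inverse_hom_pda B h M) = finals M \<times> {[]}"
  "initial_stack (inverse_hom_pda B h M) = initial_stack M"
  by (simp_all add: inverse_hom_pda_def)

lemma delta_inverse_hom_pda:
  "delta (inverse_hom_pda B h M) (p, u) (Some a) z =
     (if u = [] then apfst (\<lambda>q. (q, tl (h a))) ` delta M p (Some (hd (h a))) z else {})"
  "delta (inverse_hom_pda B h M) (p, []) None z = apfst (\<lambda>q. (q, [])) ` delta M p None z"
  "delta (inverse_hom_pda B h M) (p, b # v) None z =
     apfst (\<lambda>q. (q, b # v)) ` delta M p None z \<union> apfst (\<lambda>q. (q, v)) ` delta M p (Some b) z"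
  by (simp_all add: inverse_hom_pda_def)

text \<open>Nonempty \<open>h a\<close> makes \<open>hd (h a)\<close> and \<open>tl (h a)\<close>
  meaningful. Reading a letter with empty image would leave \<open>M\<close> in place, and such a
  move could compete with an \<epsilon>-move of \<open>M\<close>.\<close>

locale pda_inverse_hom =
  fixes M :: "('q, 'a, 'z) pda" and B :: "'b set" and h :: "'b \<Rightarrow> 'a list"
  assumes pda: "pushdown_automaton M" and finite_B: "finite B"
    and h_nonempty: "\<And>a. a \<in> B \<Longrightarrow> h a \<noteq> []"
    and h_lists: "\<And>a. a \<in> B \<Longrightarrow> h a \<in> lists (alphabet M)"
begin

abbreviation "N \<equiv> inverse_hom_pda B h M"

lemma hd_mem: "a \<in> B \<Longrightarrow> hd (h a) \<in> alphabet M"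
  using h_nonempty h_lists by (metis hd_in_set in_listsD)

lemma buffer_mem:
  assumes "(p, b # v) \<in> states N"
  shows "b \<in> alphabet M"
proof -
  obtain a where "a \<in> B" "suffix (b # v) (h a)" using assms by auto
  then have "b \<in> set (h a)" "set (h a) \<subseteq> alphabet M"
    using h_lists[of a] set_mono_suffix[of "b # v" "h a"] by auto
  then show ?thesis by blast
qed

lemma pushdown_automaton_N: "pushdown_automaton N"
proof -
  define U where "U = insert [] (\<Union>a \<in> B. set (suffixes (h a)))"
  \<comment> \<open>Every kind of transition of \<open>N\<close> attaches a fixed new buffer
    \<open>v\<close> to a transition set \<open>D\<close> of \<open>M\<close>, so this one fact
    covers them all.\<close>
  have image: "finite (apfst (\<lambda>q. (q, v)) ` D) \<and>
      apfst (\<lambda>q. (q, v)) ` D \<subseteq> (states M \<times> U) \<times> lists (stack_symbols M)"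
    if "v \<in> U" "finite D" "D \<subseteq> states M \<times> lists (stack_symbols M)" for v and D
  proof (intro conjI finite_imageI image_subsetI)
    fix y assume "y \<in> D"
    with that(3) have "y \<in> states M \<times> lists (stack_symbols M)" by (rule subsetD)
    with that(1) show "apfst (\<lambda>q. (q, v)) y \<in> (states M \<times> U) \<times> lists (stack_symbols M)"
      by (cases y) simp
  qed (rule that(2))
  have "finite (delta N (p, u) x z) \<and>
      delta N (p, u) x z \<subseteq> (states M \<times> U) \<times> lists (stack_symbols M)"
    if pu: "p \<in> states M" "u \<in> U" and x: "x \<in> insert None (Some ` B)"
      and z: "z \<in> insert None (Some ` stack_symbols M)" for p u x z
  proof -
    note eps = image[OF _ pushdown_automaton_delta[OF pda pu(1) insertI1 z]]
    note rd = image[OF _ pushdown_automaton_delta[OF pda pu(1) insertI2[OF imageI] z]]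
    show ?thesis
    proof (cases x)
      case (Some a)
      then have a: "a \<in> B" using x by auto
      then have "tl (h a) \<in> U" unfolding U_def
        by (metis UN_I in_set_suffixes insertI2 suffix_tl)
      from rd[OF this hd_mem[OF a] hd_mem[OF a]] show ?thesis
        by (simp add: Some delta_inverse_hom_pda)
    next
      case None
      show ?thesis
      proof (cases u)
        case Nil
        then show ?thesis using None eps[OF pu(2)] by (simp add: delta_inverse_hom_pda)
      next
        case (Cons b v)
        then have "v \<in> U" "b \<in> alphabet M"
          using pu buffer_mem[of p b v] by (auto simp: U_def dest: suffix_ConsD)
        then show ?thesis
          using rd[of v b] eps[OF pu(2)] by (simp add: None Cons delta_inverse_hom_pda)
      qed
    qed
  qed
  then show ?thesis
    using pda finite_B unfolding pushdown_automaton_def by (auto simp: U_def)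
qed

text \<open>With empty buffer, the rivals are reading \<open>hd (h a)\<close> and an \<epsilon>-move
  in \<open>M\<close>. With buffer \<open>b # v\<close>, \<open>N\<close> cannot read, and its
  \<epsilon>-moves come from reading \<open>b\<close> and from an \<epsilon>-move in
  \<open>M\<close>. Either way, determinism of \<open>M\<close> at a single letter gives the
  bound.\<close>

lemma deterministic_N:
  assumes "deterministic_pda M"
  shows "deterministic_pda N"
proof -
  have "card (delta N (p, u) (Some a) z) + card (delta N (p, u) None z) \<le> 1"
    if pu: "(p, u) \<in> states N" and a: "a \<in> B"
      and z: "z \<in> insert None (Some ` stack_symbols M)" for p u a z
  proof -
    have p: "p \<in> states M" using pu by simp
    have det: "card (delta M p (Some b) z) + card (delta M p None z) \<le> 1" if "b \<in> alphabet M" for b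
      using assms p z that unfolding deterministic_pda_def by blast
    have le: "card (apfst g ` delta M p y z) \<le> card (delta M p y z)"
      if "y \<in> insert None (Some ` alphabet M)" for y and g :: "'q \<Rightarrow> 'q \<times> 'a list"
      by (intro card_image_le pushdown_automaton_delta[OF pda p that z])
    show ?thesis
    proof (cases u)
      case Nil
      then show ?thesis
        using det[OF hd_mem[OF a]] hd_mem[OF a]
          le[of "Some (hd (h a))" "\<lambda>q. (q, tl (h a))"] le[of None "\<lambda>q. (q, [])"]
        by (simp add: delta_inverse_hom_pda)
    next
      case (Cons b v)
      have b: "b \<in> alphabet M" using buffer_mem pu Cons by blast
      then show ?thesis
        using det[OF b] Cons le[of "Some b" "\<lambda>q. (q, v)"] le[of None "\<lambda>q. (q, b # v)"]
          card_Un_le[of "apfst (\<lambda>q. (q, b # v)) ` delta M p None z"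
            "apfst (\<lambda>q. (q, v)) ` delta M p (Some b) z"]
        by (simp add: delta_inverse_hom_pda)
    qed
  qed
  then show ?thesis unfolding deterministic_pda_def by auto
qed

text \<open>The input still awaiting \<open>M\<close> is the buffer followed by the images of the
  unread letters. A configuration of \<open>M\<close> does not record where the buffer ends, so it
  may have several partners.\<close>

fun simulates :: "('q \<times> 'a list) \<times> 'b list \<times> 'z list \<Rightarrow> 'q \<times> 'a list \<times> 'z list \<Rightarrow> bool" where
  "simulates ((p, u), w, \<zeta>) c \<longleftrightarrow> w \<in> lists B \<and> c = (p, u @ concat (map h w), \<zeta>)"

text \<open>Reading \<open>a\<close> in \<open>N\<close> is reading \<open>hd (h a)\<close> in
  \<open>M\<close>; an \<epsilon>-move of \<open>N\<close> is either one of \<open>M\<close> or the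
  reading of the first buffered letter. No step of \<open>N\<close> leaves \<open>M\<close>
  idle.\<close>

lemma simulates_forward:
  assumes "pda_step N d d'" "simulates d c"
  shows "\<exists>c'. simulates d' c' \<and> pda_step M c c'"
  using assms(1)
proof cases
  case (read s' \<zeta>' s a \<zeta> w)
  obtain p u where s: "s = (p, u)" by (cases s)
  have a: "a \<in> B" "w \<in> lists B" and c: "c = (p, u @ h a @ concat (map h w), \<zeta>)"
    using assms(2) read by (auto simp: s)
  \<comment> \<open>With a nonempty buffer, \<open>N\<close> has no transition that reads
    input.\<close>
  have u: "u = []" using read by (auto simp: s delta_inverse_hom_pda split: if_splits)
  obtain q where q: "s' = (q, tl (h a))" "(q, \<zeta>') \<in> delta M p (Some (hd (h a))) (stack_top \<zeta>)"
    using read u by (auto simp: s delta_inverse_hom_pda)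
  have "h a = hd (h a) # tl (h a)" using h_nonempty a by simp
  then have "c = (p, hd (h a) # tl (h a) @ concat (map h w), \<zeta>)"
    unfolding c u by (metis append_Cons append_Nil)
  then show ?thesis
    using pda_step.read[OF q(2)] a read q(1) by auto
next
  case (epsilon s' \<zeta>' s \<zeta> w)
  obtain p u where s: "s = (p, u)" by (cases s)
  have w: "w \<in> lists B" and c: "c = (p, u @ concat (map h w), \<zeta>)"
    using assms(2) epsilon by (auto simp: s)
  show ?thesis
  proof (cases u)
    case Nil
    then show ?thesis using w c epsilon
      by (auto simp: s delta_inverse_hom_pda intro: pda_step.epsilon)
  next
    case (Cons b v)
    then show ?thesis using w c epsilon
      by (auto simp: s delta_inverse_hom_pda intro: pda_step.intros)
  qed
qed

text \<open>A letter read by \<open>M\<close> comes from the buffer if that is nonempty. Otherwise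
  it is the first letter of the image of the next input letter, which \<open>N\<close> then
  reads.\<close>

lemma simulates_backward:
  assumes "pda_step M c c'" "simulates d c"
  shows "\<exists>d'. simulates d' c' \<and> pda_step N d d'"
proof -
  obtain p u w \<zeta> where d: "d = ((p, u), w, \<zeta>)" by (cases d) auto
  have w: "w \<in> lists B" and c: "c = (p, u @ concat (map h w), \<zeta>)"
    using assms(2) by (auto simp: d)
  from assms(1) show ?thesis
  proof cases
    case (epsilon q \<zeta>' p' \<zeta>1 w')
    then have "((q, u), \<zeta>') \<in> delta N (p, u) None (stack_top \<zeta>)"
      using c by (cases u) (force simp: delta_inverse_hom_pda)+
    from pda_step.epsilon[OF this, of w] show ?thesis
      using c w epsilon unfolding d by (intro exI[of _ "((q, u), w, butlast \<zeta> @ \<zeta>')"]) auto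
  next
    case (read q \<zeta>' p' b \<zeta>1 w')
    show ?thesis
    proof (cases u)
      case (Cons b' v)
      then have "((q, v), \<zeta>') \<in> delta N (p, u) None (stack_top \<zeta>)"
        using c read by (force simp: delta_inverse_hom_pda)
      from pda_step.epsilon[OF this, of w] show ?thesis
        using c w read Cons unfolding d
        by (intro exI[of _ "((q, v), w, butlast \<zeta> @ \<zeta>')"]) auto
    next
      case Nil
      \<comment> \<open>The buffer is empty but \<open>M\<close> has a letter to read, so some input
        of \<open>N\<close> is left.\<close>
      then obtain a w1 where w1: "w = a # w1"
        using c read by (cases w) auto
      then have a: "a \<in> B" "w1 \<in> lists B" using w by auto
      obtain v where v: "h a = b # v" "w' = v @ concat (map h w1)"
        using c read Nil w1 h_nonempty[OF a(1)] by (cases "h a") auto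
      have "((q, v), \<zeta>') \<in> delta N (p, u) (Some a) (stack_top \<zeta>)"
        using c read Nil v by (force simp: delta_inverse_hom_pda)
      from pda_step.read[OF this, of w1] show ?thesis
        using c a read v unfolding d w1
        by (intro exI[of _ "((q, v), w1, butlast \<zeta> @ \<zeta>')"]) auto
    qed
  qed
qed

lemma pda_language_N: "pda_language N = {w \<in> lists B. concat (map h w) \<in> pda_language M}"
proof -
  have "(\<exists>q \<in> finals N. (pda_step N)\<^sup>*\<^sup>* (initial N, w, [initial_stack N]) (q, [], [])) \<longleftrightarrow>
      (\<exists>q \<in> finals M. (pda_step M)\<^sup>*\<^sup>* (initial M, concat (map h w), [initial_stack M]) (q, [], []))"
    (is "?L \<longleftrightarrow> ?R") if w: "w \<in> lists B" for w
  proof -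
    have init: "simulates (initial N, w, [initial_stack N])
        (initial M, concat (map h w), [initial_stack M])"
      using w by simp
    show ?thesis
    proof
      assume ?L
      then obtain q where q: "q \<in> finals M"
        "(pda_step N)\<^sup>*\<^sup>* (initial N, w, [initial_stack N]) ((q, []), [], [])" by auto
      have "\<exists>c. simulates ((q, []), [], []) c \<and>
          (pda_step M)\<^sup>*\<^sup>* (initial M, concat (map h w), [initial_stack M]) c"
        by (rule rtranclp_simulation[where S = simulates, OF q(2) init simulates_forward])
      then show ?R using q(1) by auto
    next
      assume ?R
      then obtain q where q: "q \<in> finals M"
        "(pda_step M)\<^sup>*\<^sup>* (initial M, concat (map h w), [initial_stack M]) (q, [], [])" by auto
      have "\<exists>d. simulates d (q, [], []) \<and>
          (pda_step N)\<^sup>*\<^sup>* (initial N, w, [initial_stack N]) d"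
        by (rule rtranclp_simulation[where S = "\<lambda>c d. simulates d c",
              OF q(2) init simulates_backward])
      then obtain d where d: "simulates d (q, [], [])"
        "(pda_step N)\<^sup>*\<^sup>* (initial N, w, [initial_stack N]) d"
        by blast
      obtain p u v \<zeta> where d_eq: "d = ((p, u), v, \<zeta>)" by (metis prod.collapse)
      \<comment> \<open>\<open>M\<close> has no input left, so the images of all letters in
        \<open>v\<close> are empty; nonempty images leave no room for any letter.\<close>
      have "v = []" using d(1) h_nonempty by (cases v) (auto simp: d_eq)
      then show ?L using d q(1) by (auto simp: d_eq)
    qed
  qed
  moreover have "concat (map h w) \<in> lists (alphabet M)" if "w \<in> lists B" for w
    using that h_lists by fastforce
  ultimately show ?thesis unfolding pda_language_def by auto
qed

end

lemma context_free_inverse_hom: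
  assumes "context_free \<Sigma> L" "finite B"
    and "\<And>a. a \<in> B \<Longrightarrow> h a \<noteq> []" "\<And>a. a \<in> B \<Longrightarrow> h a \<in> lists \<Sigma>"
  shows "context_free B {w \<in> lists B. concat (map h w) \<in> L}"
proof -
  obtain M :: "(nat, 'a, nat) pda"
    where M: "pushdown_automaton M" "alphabet M = \<Sigma>" "pda_language M = L"
    using assms(1) unfolding context_free_def by blast
  interpret pda_inverse_hom M B h using assms M by unfold_locales auto
  show ?thesis using context_freeI[OF pushdown_automaton_N] pda_language_N M by simp
qed

lemma deterministic_context_free_inverse_hom:
  assumes "deterministic_context_free \<Sigma> L" "finite B"
    and "\<And>a. a \<in> B \<Longrightarrow> h a \<noteq> []" "\<And>a. a \<in> B \<Longrightarrow> h a \<in> lists \<Sigma>"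
  shows "deterministic_context_free B {w \<in> lists B. concat (map h w) \<in> L}"
proof -
  obtain M :: "(nat, 'a, nat) pda" where M: "pushdown_automaton M" "deterministic_pda M"
      "alphabet M = \<Sigma>" "pda_language M = L"
    using assms(1) unfolding deterministic_context_free_def by blast
  interpret pda_inverse_hom M B h using assms M by unfold_locales auto
  show ?thesis
    using deterministic_context_freeI[OF pushdown_automaton_N deterministic_N] pda_language_N M
    by simp
qed

section \<open>Words over group elements\<close>

lemma word_value_simps [simp]:
  "word_value G \<psi> [] = \<one>\<^bsub>G\<^esub>"
  "word_value G \<psi> (a # w) = \<psi> a \<otimes>\<^bsub>G\<^esub> word_value G \<psi> w"
  by (simp_all add: word_value_def)

text \<open>Values depend only on \<open>mult\<close> and \<open>one\<close>, so computing in the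
  subgroup or in \<open>G\<close> makes no difference.\<close>

lemma word_value_carrier_update: "word_value (G\<lparr>carrier := H\<rparr>) \<psi> w = word_value G \<psi> w"
  by (simp add: word_value_def)

context monoid
begin

lemma word_value_closed:
  "\<psi> ` \<Sigma> \<subseteq> carrier G \<Longrightarrow> w \<in> lists \<Sigma> \<Longrightarrow> word_value G \<psi> w \<in> carrier G"
  by (induction w) auto

lemma word_value_append:
  assumes "\<psi> ` \<Sigma> \<subseteq> carrier G" "v \<in> lists \<Sigma>" "w \<in> lists \<Sigma>"
  shows "word_value G \<psi> (v @ w) = word_value G \<psi> v \<otimes> word_value G \<psi> w"
  using assms(2)
proof (induction v)
  case Nil
  then show ?case using word_value_closed[OF assms(1,3)] by simp
next
  case (Cons a v)
  then show ?case
    using assms(1) word_value_closed[OF assms(1)] assms(3)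
    by (auto simp: m_assoc image_subset_iff)
qed

text \<open>This is what makes the language of the subgroup an inverse image under the homomorphism
  extending \<open>h\<close>.\<close>

lemma word_value_concat:
  assumes "\<psi> ` \<Sigma> \<subseteq> carrier G" and "\<And>a. a \<in> B \<Longrightarrow> h a \<in> lists \<Sigma>"
    and "\<And>a. a \<in> B \<Longrightarrow> word_value G \<psi> (h a) = \<phi> a" and "w \<in> lists B"
  shows "word_value G \<psi> (concat (map h w)) = word_value G \<phi> w"
  using assms(4)
proof (induction w)
  case (Cons a w)
  moreover have "concat (map h w) \<in> lists \<Sigma>" using Cons.hyps assms(2) by fastforce
  ultimately show ?case
    using word_value_append[OF assms(1)] assms(2,3) by simp
qed simp

end

text \<open>Fix a letter \<open>b\<close> and write \<open>g\<close> as \<open>\<psi> b\<close>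
  times \<open>inv (\<psi> b) \<otimes> g\<close>. Any word for the second factor, prefixed by
  \<open>b\<close>, is nonempty and has value \<open>g\<close>.\<close>

lemma (in group) ex_nonempty_word_value:
  assumes "semigroup_presentation G \<Sigma> \<psi>" "\<Sigma> \<noteq> {}" "g \<in> carrier G"
  shows "\<exists>w \<in> lists \<Sigma>. w \<noteq> [] \<and> word_value G \<psi> w = g"
proof -
  obtain b where b: "b \<in> \<Sigma>" using assms(2) by blast
  then have \<psi>b: "\<psi> b \<in> carrier G" using assms(1) by (auto simp: semigroup_presentation_def)
  then have "inv (\<psi> b) \<otimes> g \<in> word_value G \<psi> ` lists \<Sigma>"
    using assms by (simp add: semigroup_presentation_def)
  then obtain v where "v \<in> lists \<Sigma>" "word_value G \<psi> v = inv (\<psi> b) \<otimes> g" by (metis imageE)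
  then have "word_value G \<psi> (b # v) = g" "b # v \<in> lists \<Sigma>"
    using b \<psi>b assms(3) by (simp_all flip: m_assoc)
  then show ?thesis by blast
qed

theorem lemma3p1:
  fixes G :: "('g, 'm) monoid_scheme" and K H :: "'g set"
    and \<Sigma> :: "'a set" and \<psi> :: "'a \<Rightarrow> 'g"
    and \<Sigma>' :: "'b set" and \<psi>' :: "'b \<Rightarrow> 'g"
  assumes "group G" and "finitely_generated G"
    and "subgroup K G"
    and "semigroup_presentation G \<Sigma> \<psi>"
    and "subgroup H G" and "finitely_generated (G\<lparr>carrier := H\<rparr>)"
    and "semigroup_presentation (G\<lparr>carrier := H\<rparr>) \<Sigma>' \<psi>'"
    and "context_free \<Sigma> (subgroup_language G K \<Sigma> \<psi>)"
  shows "context_free \<Sigma>' (subgroup_language (G\<lparr>carrier := H\<rparr>) (K \<inter> H) \<Sigma>' \<psi>') \<and>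
    (deterministic_context_free \<Sigma> (subgroup_language G K \<Sigma> \<psi>) \<longrightarrow>
     deterministic_context_free \<Sigma>' (subgroup_language (G\<lparr>carrier := H\<rparr>) (K \<inter> H) \<Sigma>' \<psi>'))"
proof -
  interpret group G by fact
  let ?L = "subgroup_language G K \<Sigma> \<psi>"
  let ?L' = "subgroup_language (G\<lparr>carrier := H\<rparr>) (K \<inter> H) \<Sigma>' \<psi>'"
  have \<Sigma>': "finite \<Sigma>'" "\<psi>' ` \<Sigma>' \<subseteq> H" "word_value G \<psi>' ` lists \<Sigma>' = H"
    using assms(7) by (simp_all add: semigroup_presentation_def word_value_carrier_update)
  have \<Sigma>: "\<psi> ` \<Sigma> \<subseteq> carrier G" "word_value G \<psi> ` lists \<Sigma> = carrier G"
    using assms(4) by (simp_all add: semigroup_presentation_def)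
  have H: "H \<subseteq> carrier G" using assms(5) by (rule subgroup.subset)
  \<comment> \<open>Words over \<open>\<Sigma>'\<close> have their values in \<open>H\<close>, so
    intersecting \<open>K\<close> with \<open>H\<close> changes nothing.\<close>
  have L': "?L' = {w \<in> lists \<Sigma>'. word_value G \<psi>' w \<in> K}"
    using \<Sigma>'(3) by (auto simp: subgroup_language_def word_value_carrier_update)
  show ?thesis
  proof (cases "\<Sigma> = {}")
    case True
    \<comment> \<open>The only word over the empty alphabet is \<open>[]\<close>, so surjectivity
      makes \<open>G\<close> trivial.\<close>
    then have "H \<subseteq> {\<one>\<^bsub>G\<^esub>}" using \<Sigma>(2) H by simp
    then have "word_value G \<psi>' w = \<one>\<^bsub>G\<^esub>" if "w \<in> lists \<Sigma>'" for w
      using imageI[OF that, of "word_value G \<psi>'"] \<Sigma>'(3) by auto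
    then have "word_value G \<psi>' w \<in> K" if "w \<in> lists \<Sigma>'" for w
      using that subgroup.one_closed[OF assms(3)] by simp
    then have "?L' = lists \<Sigma>'" unfolding L' by blast
    then show ?thesis
      using deterministic_context_free_lists[OF \<Sigma>'(1)]
        deterministic_context_free_imp_context_free by metis
  next
    case False
    \<comment> \<open>The values \<open>\<psi>' a\<close> lie in \<open>H\<close>, hence in
      \<open>G\<close>, and can be spelled over \<open>\<Sigma>\<close>; choosing such words defines
      \<open>h\<close>.\<close>
    have "\<forall>a \<in> \<Sigma>'. \<exists>w. w \<in> lists \<Sigma> \<and> w \<noteq> [] \<and> word_value G \<psi> w = \<psi>' a"
      using ex_nonempty_word_value[OF assms(4) False] \<Sigma>'(2) H by blast
    then obtain h where h: "\<And>a. a \<in> \<Sigma>' \<Longrightarrow> h a \<in> lists \<Sigma>" "\<And>a. a \<in> \<Sigma>' \<Longrightarrow> h a \<noteq> []"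
      "\<And>a. a \<in> \<Sigma>' \<Longrightarrow> word_value G \<psi> (h a) = \<psi>' a"
      by metis
    have "concat (map h w) \<in> lists \<Sigma> \<and> word_value G \<psi> (concat (map h w)) = word_value G \<psi>' w"
      if w: "w \<in> lists \<Sigma>'" for w
      using w h(1) word_value_concat[of \<psi> \<Sigma> \<Sigma>' h \<psi>', OF \<Sigma>(1) h(1,3) w] by fastforce
    then have "?L' = {w \<in> lists \<Sigma>'. concat (map h w) \<in> ?L}"
      unfolding L' by (simp add: subgroup_language_def cong: conj_cong)
    then show ?thesis
      using context_free_inverse_hom[OF assms(8) \<Sigma>'(1) h(2,1)]
        deterministic_context_free_inverse_hom[OF _ \<Sigma>'(1) h(2,1)] by simp
  qed
qed

end
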